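(* Let $I$ be a finite nonempty set of items, let $s(i)$ be a positive integer size for each $i\in I$, and let $f\colon 2^I\to\mathbb{R}_+$ be monotone and submodular with $f(\emptyset)=0$. Let $\Pi^1$ and $\Pi^2$ be the item sequences described in the context, and consider the randomized universal policy (with cancellation, unknown capacity) that uses $\Pi^1$ with probability $1/2$ and $\Pi^2$ with probability $1/2$. This randomized universal policy is $\frac{1}{2}\left(1-\frac{1}{\sqrt[4]{e}}\right)$-robust (where $\frac{1}{2}(1-1/\sqrt[4]{e})>0.110$); that is, for every capacity $C\in\mathbb{R}_+$, $$\frac{f(\Pi^1(C))+f(\Pi^2(C))}{2}\ \ge\ \frac12\left(1-\frac{1}{\sqrt[4]{e}}\right) f(\mathrm{OPT}_C).$$
   Context: Notation: $s(X)=\sum_{i\in X}s(i)$; $\mathrm{OPT}_C$ is a set maximizing $f(X)$ over $X\subseteq I$ with $s(X)\le C$. Universal policy with cancellation: a universal policy is a sequence $\Pi=(\Pi_1,\dots,\Pi_n)$ of the $n$ items of $I$. For capacity $C$, its output $\Pi(C)$ is built by starting with the empty set and, for $k=1,\dots,n$, adding $\Pi_k$ if the total size of the current set plus $s(\Pi_k)$ is at most $C$, and discarding $\Pi_k$ (and continuing) otherwise. A randomized universal policy is a probability distribution over such sequences; it is $\alpha$-robust if for every $C\in\mathbb{R}_+$ the expected value of $f$ on its output is at least $\alpha f(\mathrm{OPT}_C)$. Greedy procedure $\mathcal{P}^1$ with capacity $c$: start with $X=\emptyset$, $R=I$. For $j=1,\dots,|I|$: choose $i_j\in\arg\max\{(f(X\cup\{i\})-f(X))/s(i)\colon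 i\in R\}$ (ties arbitrary); if $s(X)+s(i_j)\le c$ set $X\leftarrow X\cup\{i_j\}$; in any case set $R\leftarrow R\setminus\{i_j\}$. The output is denoted $\mathcal{P}^1(c)$. Sequence $\Pi^1$: let $s_{\min}=\min_{i\in I}s(i)$. For $k=0,1,\dots,\lceil\log_2(\sum_{i\in I}s(i)/s_{\min})\rceil$ in this order, let $Y^{(k)}=\mathcal{P}^1(2^k s_{\min})$ and append to the sequence the items of $Y^{(k)}\setminus\bigcup_{j=0}^{k-1}Y^{(j)}$ in arbitrary order. Sequence $\Pi^2$: the items of $I$ in decreasing order of $f(\{i\})$ (ties arbitrary). *)

theory Defs
  imports "HOL-Probability.Probability" "HOL-Combinatorics.Multiset_Permutations"
begin

definition submodular_on :: "'a set \<Rightarrow> ('a set \<Rightarrow> real) \<Rightarrow> bool" where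
  "submodular_on I f \<longleftrightarrow>
     (\<forall>X Y. X \<subseteq> I \<longrightarrow> Y \<subseteq> I \<longrightarrow> f (X \<union> Y) + f (X \<inter> Y) \<le> f X + f Y)"

text \<open>For finite \<open>I\<close> and \<open>C \<ge> 0\<close> the maximum is attained, so the choice made by
  \<open>ARG_MAX\<close> is a genuine maximizer; the value of \<open>f\<close> at it does not depend on the choice.\<close>

definition opt_set :: "'a set \<Rightarrow> ('a \<Rightarrow> nat) \<Rightarrow> ('a set \<Rightarrow> real) \<Rightarrow> real \<Rightarrow> 'a set" where
  "opt_set I s f C = (ARG_MAX f X. X \<subseteq> I \<and> real (\<Sum>i\<in>X. s i) \<le> C)"

definition add_if_fits :: "('a \<Rightarrow> nat) \<Rightarrow> real \<Rightarrow> 'a \<Rightarrow> 'a set \<Rightarrow> 'a set" where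
  "add_if_fits s c i X = (if real ((\<Sum>j\<in>X. s j) + s i) \<le> c then insert i X else X)"

definition policy_output :: "('a \<Rightarrow> nat) \<Rightarrow> 'a list \<Rightarrow> real \<Rightarrow> 'a set" where
  "policy_output s \<sigma> C = fold (add_if_fits s C) \<sigma> {}"

text \<open>Universal policies on \<open>I\<close> are the elements of \<open>permutations_of_set I\<close>, the duplicate-free
  lists enumerating \<open>I\<close>.\<close>

definition randomized_universal_policy :: "'a set \<Rightarrow> 'a list pmf \<Rightarrow> bool" where
  "randomized_universal_policy I P \<longleftrightarrow> set_pmf P \<subseteq> permutations_of_set I"

definition robust ::
  "'a set \<Rightarrow> ('a \<Rightarrow> nat) \<Rightarrow> ('a set \<Rightarrow> real) \<Rightarrow> real \<Rightarrow> 'a list pmf \<Rightarrow> bool" where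
  "robust I s f \<alpha> P \<longleftrightarrow>
     (\<forall>C\<ge>0. measure_pmf.expectation P (\<lambda>\<sigma>. f (policy_output s \<sigma> C)) \<ge> \<alpha> * f (opt_set I s f C))"

text \<open>\<open>greedy_run s f c X R Y\<close>: with current set \<open>X\<close> and remaining items \<open>R\<close>, the greedy
  procedure with capacity \<open>c\<close> can end with output \<open>Y\<close>. It is a relation because ties between
  items of maximal density are broken arbitrarily.\<close>

inductive greedy_run ::
  "('a \<Rightarrow> nat) \<Rightarrow> ('a set \<Rightarrow> real) \<Rightarrow> real \<Rightarrow> 'a set \<Rightarrow> 'a set \<Rightarrow> 'a set \<Rightarrow> bool"
  for s f c where
  finished: "greedy_run s f c X {} X"
| step: "is_arg_max (\<lambda>i. (f (X \<union> {i}) - f X) / real (s i)) (\<lambda>i. i \<in> R) i \<Longrightarrow>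
     greedy_run s f c (add_if_fits s c i X) (R - {i}) Y \<Longrightarrow> greedy_run s f c X R Y"

definition greedy_output ::
  "'a set \<Rightarrow> ('a \<Rightarrow> nat) \<Rightarrow> ('a set \<Rightarrow> real) \<Rightarrow> real \<Rightarrow> 'a set \<Rightarrow> bool" where
  "greedy_output I s f c Y \<longleftrightarrow> greedy_run s f c {} I Y"

definition min_size :: "'a set \<Rightarrow> ('a \<Rightarrow> nat) \<Rightarrow> nat" where
  "min_size I s = Min (s ` I)"

text \<open>The logarithm is nonnegative for nonempty \<open>I\<close> and positive sizes, so \<open>nat\<close> does not
  truncate.\<close>

definition last_phase :: "'a set \<Rightarrow> ('a \<Rightarrow> nat) \<Rightarrow> nat" where
  "last_phase I s = nat \<lceil>log 2 (real (\<Sum>i\<in>I. s i) / real (min_size I s))\<rceil>"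

text \<open>\<open>B k\<close> lists, in arbitrary order, the items appended in phase \<open>k\<close>. Ties in different
  phases may be broken independently.\<close>

definition is_doubling_sequence ::
  "'a set \<Rightarrow> ('a \<Rightarrow> nat) \<Rightarrow> ('a set \<Rightarrow> real) \<Rightarrow> 'a list \<Rightarrow> bool" where
  "is_doubling_sequence I s f \<sigma> \<longleftrightarrow>
     (\<exists>Y B. (\<forall>k\<le>last_phase I s.
               greedy_output I s f (2 ^ k * real (min_size I s)) (Y k) \<and>
               B k \<in> permutations_of_set (Y k - (\<Union>j<k. Y j))) \<and>
            \<sigma> = concat (map B [0..<Suc (last_phase I s)]))"

definition is_value_sequence :: "'a set \<Rightarrow> ('a set \<Rightarrow> real) \<Rightarrow> 'a list \<Rightarrow> bool" where
  "is_value_sequence I f \<sigma> \<longleftrightarrow>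
     \<sigma> \<in> permutations_of_set I \<and> sorted_wrt (\<lambda>i j. f {i} \<ge> f {j}) \<sigma>"

definition fair_mix :: "'a list \<Rightarrow> 'a list \<Rightarrow> 'a list pmf" where
  "fair_mix \<sigma>1 \<sigma>2 = map_pmf (\<lambda>b. if b then \<sigma>1 else \<sigma>2) (bernoulli_pmf (1/2))"

end

theory Submission imports Defs begin

text \<open>The value sequence packs the most valuable item that fits into \<open>C\<close>, since every
  earlier item exceeds \<open>C\<close> on its own. In the doubling sequence, phases \<open>0, \<dots>, k\<close> have
  total size at most \<open>(2 ^ (k + 1) - 1) s\<^sub>m\<^sub>i\<^sub>n\<close>; for the largest \<open>k\<close> such that this is
  at most \<open>C\<close> they are packed completely, and phase \<open>k\<close> is a greedy run with capacity
  \<open>c = 2 ^ k s\<^sub>m\<^sub>i\<^sub>n \<ge> C / 4\<close>. Until this run discards an item of size at most \<open>C\<close>, it has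
  discarded no item of the optimum, so each step shrinks the gap to the optimum by the factor
  \<open>1 - s i / C \<le> exp (- s i / C)\<close>. Adding the first discarded item \<open>i\<close> with \<open>s i \<le> C\<close> would
  bring the size above \<open>c\<close> and hence the value to \<open>1 - exp (- 1 / 4)\<close> times the optimum; by
  submodularity that value is at most the one of the greedy output plus \<open>f {i}\<close>, and the second
  summand is covered by the value sequence.\<close>

section \<open>Monotone and submodular set functions\<close>

lemma mono_on_PowD:
  assumes "mono_on (Pow I) f" "X \<subseteq> Y" "Y \<subseteq> I"
  shows "f X \<le> f Y"
  using assms by (auto simp: monotone_on_def)

lemma submodular_onD:
  assumes "submodular_on I f" "X \<subseteq> I" "Y \<subseteq> I"
  shows "f (X \<union> Y) + f (X \<inter> Y) \<le> f X + f Y"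
  using assms by (simp add: submodular_on_def)

text \<open>Induction on \<open>T\<close>: for a new \<open>t\<close> outside \<open>X\<close>, the
  sets \<open>X \<union> T\<close> and \<open>X \<union> {t}\<close> meet exactly in
  \<open>X\<close>, so submodularity bounds the gain of \<open>t\<close> over
  \<open>X \<union> T\<close> by its gain over \<open>X\<close>.\<close>

lemma submodular_on_marginals:
  assumes "submodular_on I f" "finite T" "X \<subseteq> I" "T \<subseteq> I"
  shows "f (X \<union> T) - f X \<le> (\<Sum>t\<in>T - X. f (X \<union> {t}) - f X)"
  using assms(2,4)
proof (induction T rule: finite_induct)
  case empty
  then show ?case by simp
next
  case (insert t T)
  have IH: "f (X \<union> T) - f X \<le> (\<Sum>t\<in>T - X. f (X \<union> {t}) - f X)"
    using insert by auto
  show ?case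
  proof (cases "t \<in> X")
    case True
    then have "X \<union> insert t T = X \<union> T" "insert t T - X = T - X" by auto
    then show ?thesis using IH by simp
  next
    case False
    have "f ((X \<union> T) \<union> (X \<union> {t})) + f ((X \<union> T) \<inter> (X \<union> {t})) \<le> f (X \<union> T) + f (X \<union> {t})"
      by (rule submodular_onD[OF assms(1)]) (use assms(3) insert.prems in auto)
    moreover have "(X \<union> T) \<union> (X \<union> {t}) = X \<union> insert t T" "(X \<union> T) \<inter> (X \<union> {t}) = X"
      using insert.hyps by auto
    ultimately have "f (X \<union> insert t T) + f X \<le> f (X \<union> T) + f (X \<union> {t})" by simp
    moreover have "insert t T - X = insert t (T - X)" "t \<notin> T - X" "finite (T - X)"
      using False insert.hyps by auto
    ultimately show ?thesis using IH by simp
  qed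
qed

section \<open>Existence of an optimal set\<close>

text \<open>\<open>ARG_MAX\<close> is meaningful only if a maximizer exists. There are finitely many
  candidates, and \<open>C \<ge> 0\<close> makes the empty set one of them.\<close>

lemma opt_set_feasible:
  assumes "finite I" "C \<ge> 0"
  shows "opt_set I s f C \<subseteq> I" "real (\<Sum>i\<in>opt_set I s f C. s i) \<le> C"
proof -
  let ?P = "\<lambda>X. X \<subseteq> I \<and> real (\<Sum>i\<in>X. s i) \<le> C"
  have "finite (Collect ?P)"
    by (rule finite_subset[of _ "Pow I"]) (use assms in auto)
  moreover have "Collect ?P \<noteq> {}"
    using assms by (auto intro!: exI[of _ "{}"])
  ultimately have "Max (f ` Collect ?P) \<in> f ` Collect ?P"
    by (intro Max_in) simp_all
  then obtain X where X: "Max (f ` Collect ?P) = f X" "X \<in> Collect ?P"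
    by (rule imageE)
  have "f Z \<le> f X" if "?P Z" for Z
    unfolding X(1)[symmetric]
    by (rule Max_ge) (use \<open>finite (Collect ?P)\<close> that in auto)
  then have "is_arg_max f ?P X"
    using X(2) unfolding is_arg_max_linorder by blast
  then have "is_arg_max f ?P (opt_set I s f C)"
    unfolding opt_set_def arg_max_def by (rule someI)
  then show "opt_set I s f C \<subseteq> I" "real (\<Sum>i\<in>opt_set I s f C. s i) \<le> C"
    by (auto simp: is_arg_max_def)
qed

section \<open>Packing a list of items with cancellation\<close>

lemma fold_add_if_fits_mono: "X \<subseteq> fold (add_if_fits s C) xs X"
proof (induction xs arbitrary: X)
  case (Cons x xs)
  have "X \<subseteq> add_if_fits s C x X" by (auto simp: add_if_fits_def)
  with Cons[of "add_if_fits s C x X"] show ?case by simp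
qed simp

lemma fold_add_if_fits_subset: "fold (add_if_fits s C) xs X \<subseteq> X \<union> set xs"
proof (induction xs arbitrary: X)
  case (Cons x xs)
  have "add_if_fits s C x X \<subseteq> insert x X" by (auto simp: add_if_fits_def)
  with Cons[of "add_if_fits s C x X"] show ?case by auto
qed simp

text \<open>Every intermediate set is contained in the final union, and sizes are natural numbers,
  so no capacity test fails.\<close>

lemma fold_add_if_fits_all:
  assumes "distinct xs" "finite X" "X \<inter> set xs = {}" "real (\<Sum>j\<in>X \<union> set xs. s j) \<le> C"
  shows "fold (add_if_fits s C) xs X = X \<union> set xs"
  using assms
proof (induction xs arbitrary: X)
  case (Cons x xs)
  have "(\<Sum>j\<in>X. s j) + s x = (\<Sum>j\<in>insert x X. s j)"
    using Cons.prems by simp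
  also have "\<dots> \<le> (\<Sum>j\<in>X \<union> set (x # xs). s j)"
    by (rule sum_mono2) (use Cons.prems in auto)
  finally have "real ((\<Sum>j\<in>X. s j) + s x) \<le> C" using Cons.prems(4) by linarith
  then have "add_if_fits s C x X = insert x X" by (simp add: add_if_fits_def)
  moreover have "fold (add_if_fits s C) xs (insert x X) = insert x X \<union> set xs"
    by (rule Cons.IH) (use Cons.prems in auto)
  ultimately show ?case by simp
qed simp

text \<open>Packing starts from the empty set: the first item that fits alone is always packed, and
  no item of larger value fits. Items before it are discarded and leave the set empty.\<close>

lemma policy_output_value_sequence:
  assumes "sorted_wrt (\<lambda>i j. f {i} \<ge> f {j}) xs" "i \<in> set xs" "real (s i) \<le> C"
  shows "\<exists>j\<in>policy_output s xs C. f {i} \<le> (f {j} :: real)"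
  using assms
proof (induction xs)
  case (Cons x xs)
  show ?case
  proof (cases "real (s x) \<le> C")
    case True
    then have "x \<in> policy_output s (x # xs) C"
      using fold_add_if_fits_mono[of "{x}" s C xs]
      by (simp add: policy_output_def add_if_fits_def)
    moreover have "f {i} \<le> f {x}" using Cons.prems by auto
    ultimately show ?thesis by blast
  next
    case False
    then have "policy_output s (x # xs) C = policy_output s xs C" "i \<in> set xs"
      using Cons.prems by (auto simp: policy_output_def add_if_fits_def)
    then show ?thesis using Cons by simp
  qed
qed simp

section \<open>Contents and sizes of greedy runs\<close>

lemma greedy_run_bounds:
  assumes "greedy_run s f c X R Y"
  shows "X \<subseteq> Y" "Y \<subseteq> X \<union> R"
  using assms by (induction rule: greedy_run.induct)
    (auto simp: add_if_fits_def is_arg_max_def split: if_splits)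

lemma greedy_run_size:
  assumes "greedy_run s f c X R Y" "finite X" "X \<inter> R = {}" "real (\<Sum>i\<in>X. s i) \<le> c"
  shows "real (\<Sum>i\<in>Y. s i) \<le> c"
  using assms
proof (induction rule: greedy_run.induct)
  case (step X R i Y)
  then have "i \<notin> X" by (auto simp: is_arg_max_def)
  then show ?case using step by (auto simp: add_if_fits_def split: if_splits)
qed

text \<open>Meant for the last phase, whose capacity covers all of \<open>I\<close>: no item is ever
  discarded.\<close>

lemma greedy_run_all:
  assumes "greedy_run s f c X R Y" "finite X" "finite R" "X \<inter> R = {}"
    and "real (\<Sum>i\<in>X \<union> R. s i) \<le> c"
  shows "Y = X \<union> R"
  using assms
proof (induction rule: greedy_run.induct)
  case (step X R i Y)
  then have i: "i \<in> R" "i \<notin> X" by (auto simp: is_arg_max_def)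
  then have "(\<Sum>j\<in>X. s j) + s i = (\<Sum>j\<in>insert i X. s j)"
    using step.prems by simp
  also have "\<dots> \<le> (\<Sum>j\<in>X \<union> R. s j)"
    by (rule sum_mono2) (use i step.prems in auto)
  finally have "real ((\<Sum>j\<in>X. s j) + s i) \<le> c" using step.prems(4) by linarith
  then have eq: "add_if_fits s c i X = insert i X" by (simp add: add_if_fits_def)
  have "insert i X \<union> (R - {i}) = X \<union> R" using i by auto
  then show ?case using step.IH step.prems unfolding eq by auto
qed simp

section \<open>Value guarantee of a greedy run\<close>

text \<open>Every item of \<open>T - X\<close> is still in \<open>R\<close>, so its density is at
  most that of \<open>i\<close>. Summing the marginal gains gives at most this density times the
  size of \<open>T\<close>.\<close>

lemma greedy_step_gain:
  assumes "finite I" "submodular_on I f" "mono_on (Pow I) f"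
    and pos: "\<And>i. i \<in> I \<Longrightarrow> s i > 0"
    and "X \<subseteq> I" "R \<subseteq> I" "T \<subseteq> X \<union> R" "real (\<Sum>i\<in>T. s i) \<le> C" "C > 0"
    and arg: "is_arg_max (\<lambda>i. (f (X \<union> {i}) - f X) / real (s i)) (\<lambda>i. i \<in> R) i"
  shows "f T - f X \<le> C / real (s i) * (f (X \<union> {i}) - f X)"
proof -
  let ?d = "(f (X \<union> {i}) - f X) / real (s i)"
  have i: "i \<in> R" and max: "\<And>t. t \<in> R \<Longrightarrow> (f (X \<union> {t}) - f X) / real (s t) \<le> ?d"
    using arg by (auto simp: is_arg_max_linorder)
  have TI: "T \<subseteq> I" using assms by auto
  have fin: "finite T" using TI assms(1) finite_subset by blast
  \<comment> \<open>Monotonicity makes the density \<open>?d\<close> nonnegative, which allows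
    replacing the size of \<open>T - X\<close> by \<open>C\<close> below.\<close>
  have "f X \<le> f (X \<union> {i})"
    by (rule mono_on_PowD[OF assms(3)]) (use assms(5,6) i in auto)
  then have d: "?d \<ge> 0" by simp
  have "f T \<le> f (X \<union> T)"
    by (rule mono_on_PowD[OF assms(3)]) (use assms(5) TI in auto)
  then have "f T - f X \<le> f (X \<union> T) - f X" by simp
  also have "\<dots> \<le> (\<Sum>t\<in>T - X. f (X \<union> {t}) - f X)"
    by (rule submodular_on_marginals[OF assms(2) fin assms(5) TI])
  also have "\<dots> \<le> (\<Sum>t\<in>T - X. ?d * real (s t))"
  proof (rule sum_mono)
    fix t assume t: "t \<in> T - X"
    then have "t \<in> R" "s t > 0" using assms(7) TI pos by auto
    then show "f (X \<union> {t}) - f X \<le> ?d * real (s t)"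
      using max[of t] by (simp add: pos_divide_le_eq)
  qed
  also have "\<dots> = ?d * real (\<Sum>t\<in>T - X. s t)"
    by (simp add: sum_distrib_left)
  also have "\<dots> \<le> ?d * C"
  proof (rule mult_left_mono[OF _ d])
    have "(\<Sum>t\<in>T - X. s t) \<le> (\<Sum>t\<in>T. s t)"
      by (rule sum_mono2) (use fin in auto)
    then show "real (\<Sum>t\<in>T - X. s t) \<le> C" using assms(8) by linarith
  qed
  finally show ?thesis by (simp add: mult.commute)
qed

text \<open>To be read with \<open>F = f T\<close>, \<open>a = f X\<close>,
  \<open>b = f (insert i X)\<close>, and \<open>\<sigma>\<close>, \<open>\<tau>\<close> the sizes of
  \<open>X\<close> and \<open>i\<close>. The gap \<open>F - a\<close> shrinks by the factor
  \<open>1 - \<tau> / C\<close>, which is at most \<open>exp (- \<tau> / C)\<close>.\<close>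

lemma exponential_gap_step:
  fixes C a b F \<sigma> \<tau> :: real
  assumes gain: "F - a \<le> C / \<tau> * (b - a)" and "C > 0" "\<tau> > 0" "F \<ge> 0" "a \<le> b"
    and inv: "(1 - exp (- \<sigma> / C)) * F \<le> a"
  shows "(1 - exp (- (\<sigma> + \<tau>) / C)) * F \<le> b"
proof (cases "a \<le> F")
  case True
  have "\<tau> / C * (F - a) \<le> b - a"
    using gain assms(2,3) by (simp add: field_simps)
  then have "F - b \<le> (1 - \<tau> / C) * (F - a)" by (simp add: algebra_simps)
  also have "\<dots> \<le> exp (- \<tau> / C) * (F - a)"
    using exp_ge_add_one_self[of "- \<tau> / C"] True by (intro mult_right_mono) auto
  also have "\<dots> \<le> exp (- \<tau> / C) * (exp (- \<sigma> / C) * F)"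
    using inv by (intro mult_left_mono) (auto simp: algebra_simps)
  also have "\<dots> = exp (- (\<sigma> + \<tau>) / C) * F"
    by (simp add: exp_add[symmetric] add_divide_distrib diff_divide_distrib)
  finally show ?thesis by (simp add: algebra_simps)
next
  \<comment> \<open>A negative \<open>F - a\<close> would reverse the exponential estimate, but then
    \<open>b\<close> already exceeds \<open>F\<close>.\<close>
  case False
  have "(1 - exp (- (\<sigma> + \<tau>) / C)) * F \<le> 1 * F"
    using \<open>F \<ge> 0\<close> by (intro mult_right_mono) auto
  then show ?thesis using False \<open>a \<le> b\<close> by simp
qed

text \<open>\<open>T\<close> plays the role of the optimum; the run may discard items of size above \<open>C\<close>, which
  are not in \<open>T\<close>, without losing \<open>T \<subseteq> X \<union> R\<close>.\<close>

lemma greedy_run_approx: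
  assumes run: "greedy_run s f c X R Y"
    and I: "finite I" "submodular_on I f" "mono_on (Pow I) f" "f {} = 0"
    and nonneg: "\<And>X. X \<subseteq> I \<Longrightarrow> f X \<ge> 0"
    and pos: "\<And>i. i \<in> I \<Longrightarrow> s i > 0"
    and T: "real (\<Sum>i\<in>T. s i) \<le> C" "C > 0" "\<theta> * C \<le> c"
    and v: "v \<ge> 0" "\<And>i. i \<in> I \<Longrightarrow> real (s i) \<le> C \<Longrightarrow> f {i} \<le> v"
    and "X \<subseteq> I" "R \<subseteq> I" "X \<inter> R = {}" "T \<subseteq> X \<union> R"
    and "(1 - exp (- real (\<Sum>i\<in>X. s i) / C)) * f T \<le> f X"
  shows "(1 - exp (- \<theta>)) * f T \<le> f Y + v"
  \<comment> \<open>Only the invariants on \<open>X\<close> and \<open>R\<close> vary during the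
    induction; \<open>T\<close>, \<open>v\<close> and the capacities stay fixed.\<close>
  using run assms(13-)
proof (induction rule: greedy_run.induct)
  case (finished X)
  then have "T \<subseteq> I" by auto
  have "f T \<le> f X"
    by (rule mono_on_PowD[OF I(3)]) (use finished in auto)
  moreover have "(1 - exp (- \<theta>)) * f T \<le> 1 * f T"
    using nonneg[OF \<open>T \<subseteq> I\<close>] by (intro mult_right_mono) auto
  ultimately show ?case using v(1) by simp
next
  case (step X R i Y)
  have i: "i \<in> R" "i \<in> I" "i \<notin> X"
    using step.hyps(1) step.prems by (auto simp: is_arg_max_def)
  have fins: "finite X" "T \<subseteq> I" "finite T"
    using step.prems I(1) finite_subset[of X I] finite_subset[of T I] by auto
  have sum_insert: "real (\<Sum>j\<in>insert i X. s j) = real (\<Sum>j\<in>X. s j) + real (s i)"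
    using i fins by simp
  have "f X \<le> f (X \<union> {i})"
    by (rule mono_on_PowD[OF I(3)]) (use step.prems i in auto)
  moreover have "f T - f X \<le> C / real (s i) * (f (X \<union> {i}) - f X)"
    by (rule greedy_step_gain[of I f s, OF I(1-3) pos step.prems(1,2,4) T(1,2) step.hyps(1)])
  \<comment> \<open>This concerns the hypothetical set \<open>insert i X\<close>, so it is available
    even when \<open>i\<close> is discarded.\<close>
  ultimately have gap:
    "(1 - exp (- real (\<Sum>j\<in>insert i X. s j) / C)) * f T \<le> f (insert i X)"
    unfolding sum_insert
    using exponential_gap_step[OF _ T(2) _ nonneg[OF fins(2)] _ step.prems(5)] pos[OF i(2)]
    by auto
  consider "real (\<Sum>j\<in>insert i X. s j) \<le> c"
    | "real (\<Sum>j\<in>insert i X. s j) > c" "real (s i) \<le> C"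
    | "real (\<Sum>j\<in>insert i X. s j) > c" "real (s i) > C"
    by linarith
  then show ?case
  proof cases
    case 1
    then have "add_if_fits s c i X = insert i X"
      unfolding add_if_fits_def using sum_insert by simp
    moreover have "insert i X \<subseteq> I" "R - {i} \<subseteq> I" "insert i X \<inter> (R - {i}) = {}"
      "T \<subseteq> insert i X \<union> (R - {i})"
      using step.prems i by auto
    ultimately show ?thesis using step.IH gap by metis
  next
    case 2
    \<comment> \<open>The run is not followed beyond this discard. Overflowing \<open>c\<close>
      already brings the hypothetical set to the target value; \<open>f {i}\<close> is then split
      off and charged to \<open>v\<close>, and later steps can only enlarge
      \<open>X\<close>.\<close>
    have "\<theta> \<le> real (\<Sum>j\<in>insert i X. s j) / C"
      using 2(1) T(2,3) by (simp add: pos_le_divide_eq del: of_nat_sum)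
    then have "(1 - exp (- \<theta>)) * f T
        \<le> (1 - exp (- real (\<Sum>j\<in>insert i X. s j) / C)) * f T"
      using nonneg[OF fins(2)] by (intro mult_right_mono) auto
    also have "\<dots> \<le> f (insert i X)" by (rule gap)
    also have "\<dots> \<le> f X + f {i}"
    proof -
      have "f (X \<union> {i}) + f (X \<inter> {i}) \<le> f X + f {i}"
        by (rule submodular_onD[OF I(2)]) (use step.prems i in auto)
      then show ?thesis using i I(4) by simp
    qed
    also have "f X \<le> f Y"
    proof (rule mono_on_PowD[OF I(3)])
      have "greedy_run s f c X R Y" using step.hyps by (rule greedy_run.step)
      from greedy_run_bounds[OF this] show "X \<subseteq> Y" "Y \<subseteq> I"
        using step.prems by auto
    qed
    also have "f {i} \<le> v" using v(2) i 2 by simp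
    finally show ?thesis by simp
  next
    case 3
    have "i \<notin> T"
    proof
      assume "i \<in> T"
      then have "s i \<le> (\<Sum>j\<in>T. s j)" using fins by (intro member_le_sum) auto
      then show False using 3 T(1) by linarith
    qed
    moreover have "add_if_fits s c i X = X"
      unfolding add_if_fits_def using sum_insert 3 by simp
    moreover from \<open>i \<notin> T\<close> have "R - {i} \<subseteq> I" "X \<inter> (R - {i}) = {}" "T \<subseteq> X \<union> (R - {i})"
      using step.prems by auto
    ultimately show ?thesis using step.IH step.prems(1,5) by metis
  qed
qed

text \<open>At the empty set the exponential is 1, so the invariant of
  \<open>greedy_run_approx\<close> holds initially by \<open>f {} = 0\<close>.\<close>

lemma greedy_output_approx:
  assumes "greedy_output I s f c Y"
    and "finite I" "submodular_on I f" "mono_on (Pow I) f" "f {} = 0"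
    and "\<And>X. X \<subseteq> I \<Longrightarrow> f X \<ge> 0"
    and "\<And>i. i \<in> I \<Longrightarrow> s i > 0"
    and "T \<subseteq> I" "real (\<Sum>i\<in>T. s i) \<le> C" "C > 0" "\<theta> * C \<le> c"
    and "v \<ge> 0" "\<And>i. i \<in> I \<Longrightarrow> real (s i) \<le> C \<Longrightarrow> f {i} \<le> v"
  shows "(1 - exp (- \<theta>)) * f T \<le> f Y + v"
  by (rule greedy_run_approx[where X = "{}" and R = I and I = I and s = s and c = c and C = C])
    (use assms in \<open>auto simp: greedy_output_def\<close>)

section \<open>Prefixes of the doubling sequence\<close>

text \<open>A geometric sum; items shared by several phases are counted repeatedly, which only
  increases the bound.\<close>

lemma prefix_sizes_doubling:
  assumes "\<And>j. j \<le> k \<Longrightarrow> finite (Y j) \<and> real (\<Sum>i\<in>Y j. s i) \<le> 2 ^ j * m"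
  shows "real (\<Sum>i\<in>(\<Union>j\<le>k. Y j). s i) \<le> (2 ^ Suc k - 1) * (m :: real)"
  using assms
proof (induction k)
  case (Suc k)
  have "(\<Sum>i\<in>(\<Union>j\<le>Suc k. Y j). s i) = (\<Sum>i\<in>(\<Union>j\<le>k. Y j) \<union> Y (Suc k). s i)"
    by (simp add: atMost_Suc Un_commute)
  also have "\<dots> \<le> (\<Sum>i\<in>(\<Union>j\<le>k. Y j). s i) + (\<Sum>i\<in>Y (Suc k). s i)"
    using Suc.prems by (subst sum_Un_nat) auto
  finally have "real (\<Sum>i\<in>(\<Union>j\<le>Suc k. Y j). s i)
      \<le> real (\<Sum>i\<in>(\<Union>j\<le>k. Y j). s i) + real (\<Sum>i\<in>Y (Suc k). s i)"
    by linarith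
  also have "\<dots> \<le> (2 ^ Suc k - 1) * m + 2 ^ Suc k * m"
    using Suc.prems[of "Suc k"] Suc.IH[OF Suc.prems] by (intro add_mono) auto
  finally show ?case by (simp add: algebra_simps)
qed simp

lemma concat_new_items:
  assumes "\<And>j. j < n \<Longrightarrow> B j \<in> permutations_of_set (Y j - (\<Union>i<j. Y i))"
  shows "distinct (concat (map B [0..<n])) \<and> set (concat (map B [0..<n])) = (\<Union>j<n. Y j)"
  using assms
proof (induction n)
  case (Suc n)
  have "set (B n) = Y n - (\<Union>i<n. Y i)" "distinct (B n)"
    using Suc.prems[of n] by (auto simp: permutations_of_set_def)
  then show ?case using Suc by (auto simp: lessThan_Suc)
qed simp

lemma total_size_le_last_phase:
  assumes "finite I" "I \<noteq> {}" "\<And>i. i \<in> I \<Longrightarrow> s i > 0"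
  shows "min_size I s > 0" "real (\<Sum>i\<in>I. s i) \<le> 2 ^ last_phase I s * real (min_size I s)"
proof -
  show m: "min_size I s > 0" using assms by (simp add: min_size_def)
  have S: "(\<Sum>i\<in>I. s i) > 0" using assms by (intro sum_pos) auto
  let ?q = "real (\<Sum>i\<in>I. s i) / real (min_size I s)"
  have q: "?q > 0" using m S by (intro divide_pos_pos) linarith+
  \<comment> \<open>Both the ceiling and \<open>nat\<close> can only increase the value, so no sign
    condition on the logarithm enters.\<close>
  have "log 2 ?q \<le> real (last_phase I s)" unfolding last_phase_def by linarith
  then have "?q \<le> 2 powr real (last_phase I s)"
    using q by (subst (asm) log_le_iff) auto
  then show "real (\<Sum>i\<in>I. s i) \<le> 2 ^ last_phase I s * real (min_size I s)"
    using m by (simp add: powr_realpow pos_divide_le_eq del: of_nat_sum)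
qed

section \<open>Combining the two sequences\<close>

text \<open>The sum of both outputs is twice the expected value of the fair mixture, hence no factor
  1/2 here.\<close>

lemma mix_approx:
  assumes I: "finite I" "I \<noteq> {}"
    and pos: "\<And>i. i \<in> I \<Longrightarrow> s i > 0"
    and nonneg: "\<And>X. X \<subseteq> I \<Longrightarrow> f X \<ge> 0"
    and mono: "mono_on (Pow I) f" and sub: "submodular_on I f" and f0: "f {} = 0"
    and d: "is_doubling_sequence I s f \<sigma>1" and val: "is_value_sequence I f \<sigma>2"
  shows "\<sigma>1 \<in> permutations_of_set I"
    and "C \<ge> 0 \<Longrightarrow> (1 - exp (- (1 / 4))) * f (opt_set I s f C)
           \<le> f (policy_output s \<sigma>1 C) + f (policy_output s \<sigma>2 C)"
proof -
  let ?K = "last_phase I s"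
  define m where "m = min_size I s"
  from d obtain Y B where
    Y: "\<And>k. k \<le> ?K \<Longrightarrow> greedy_output I s f (2 ^ k * real m) (Y k)" and
    B: "\<And>k. k \<le> ?K \<Longrightarrow> B k \<in> permutations_of_set (Y k - (\<Union>j<k. Y j))" and
    \<sigma>1: "\<sigma>1 = concat (map B [0..<Suc ?K])"
    unfolding is_doubling_sequence_def m_def by blast
  have m: "m > 0" "real (\<Sum>i\<in>I. s i) \<le> 2 ^ ?K * real m"
    unfolding m_def using total_size_le_last_phase[of I s] I pos by auto
  have YI: "Y k \<subseteq> I" if "k \<le> ?K" for k
    using greedy_run_bounds(2)[OF Y[OF that, unfolded greedy_output_def]] by simp
  \<comment> \<open>The last capacity is at least the total size, so the doubling sequence
    enumerates all items.\<close>
  have YK: "Y ?K = I"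
    using greedy_run_all[OF Y[OF order.refl, unfolded greedy_output_def]] I m by simp
  have items: "distinct (concat (map B [0..<Suc k])) \<and>
      set (concat (map B [0..<Suc k])) = (\<Union>j\<le>k. Y j)" if "k \<le> ?K" for k
    using concat_new_items[of "Suc k" B Y] B that by (auto simp: lessThan_Suc_atMost)
  have "(\<Union>j\<le>?K. Y j) = I" using YK YI by blast
  then show perm: "\<sigma>1 \<in> permutations_of_set I"
    using items[OF order.refl] unfolding \<sigma>1 permutations_of_set_def by blast
  have outI: "policy_output s \<sigma> C \<subseteq> I" if "\<sigma> \<in> permutations_of_set I" for \<sigma>
    using fold_add_if_fits_subset[of s C \<sigma> "{}"] that
    by (auto simp: policy_output_def permutations_of_set_def)
  have \<sigma>2: "\<sigma>2 \<in> permutations_of_set I" "sorted_wrt (\<lambda>i j. f {i} \<ge> f {j}) \<sigma>2"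
    using val by (auto simp: is_value_sequence_def)
  define T where "T = opt_set I s f C"
  \<comment> \<open>\<open>v\<close> serves as the bound on values of single fitting items that
    \<open>greedy_output_approx\<close> asks for.\<close>
  define v where "v = f (policy_output s \<sigma>2 C)"
  have v0: "v \<ge> 0" unfolding v_def using outI[OF \<sigma>2(1)] nonneg by blast
  have v: "f {i} \<le> v" if i: "i \<in> I" "real (s i) \<le> C" for i
  proof -
    have "i \<in> set \<sigma>2" using \<sigma>2(1) i by (auto simp: permutations_of_set_def)
    from policy_output_value_sequence[where f = f and s = s, OF \<sigma>2(2) this i(2)]
    obtain j where j: "j \<in> policy_output s \<sigma>2 C" "f {i} \<le> f {j}" by blast
    have "f {j} \<le> v"
      unfolding v_def by (rule mono_on_PowD[OF mono]) (use j(1) outI[OF \<sigma>2(1)] in auto)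
    then show ?thesis using j(2) by simp
  qed
  \<comment> \<open>Phases up to \<open>k\<close> form a prefix of \<open>\<sigma>1\<close> that
    fits as a whole; the items after it cannot remove anything.\<close>
  have fY: "f (Y k) \<le> f (policy_output s \<sigma>1 C)"
    if k: "k \<le> ?K" and fits: "(2 ^ Suc k - 1) * real m \<le> C" for k
  proof (rule mono_on_PowD[OF mono])
    let ?xs = "concat (map B [0..<Suc k])"
    have "real (\<Sum>i\<in>(\<Union>j\<le>k. Y j). s i) \<le> (2 ^ Suc k - 1) * real m"
    proof (rule prefix_sizes_doubling)
      fix j assume "j \<le> k"
      then show "finite (Y j) \<and> real (\<Sum>i\<in>Y j. s i) \<le> 2 ^ j * real m"
        using greedy_run_size[OF Y[of j, unfolded greedy_output_def]] k
          finite_subset[OF YI[of j] I(1)] by auto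
    qed
    then have "fold (add_if_fits s C) ?xs {} = {} \<union> set ?xs"
      using items[OF k] fits by (intro fold_add_if_fits_all) auto
    moreover have "\<sigma>1 = ?xs @ concat (map B [Suc k..<Suc ?K])"
    proof -
      have "[0..<Suc ?K] = [0..<Suc k] @ [Suc k..<Suc ?K]"
        using k upt_add_eq_append[of 0 "Suc k" "?K - k"] by simp
      then show ?thesis unfolding \<sigma>1 by (simp only: map_append concat_append)
    qed
    ultimately have "set ?xs \<subseteq> policy_output s \<sigma>1 C"
      unfolding policy_output_def
      using fold_add_if_fits_mono[of "set ?xs" s C "concat (map B [Suc k..<Suc ?K])"]
      by (simp only: fold_append o_apply) simp
    then show "Y k \<subseteq> policy_output s \<sigma>1 C" using items[OF k] by blast
    show "policy_output s \<sigma>1 C \<subseteq> I" by (rule outI[OF perm])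
  qed
  show "(1 - exp (- (1 / 4))) * f (opt_set I s f C)
           \<le> f (policy_output s \<sigma>1 C) + f (policy_output s \<sigma>2 C)" if C: "C \<ge> 0"
  proof -
    note T = opt_set_feasible[OF I(1) C, of s f, folded T_def]
    \<comment> \<open>The third condition says that the capacity of phase \<open>k\<close> is at
      least \<open>C / 4\<close>; this is where \<open>\<theta> = 1 / 4\<close> comes from.\<close>
    have approx: "(1 - exp (- (1 / 4))) * f T \<le> f (policy_output s \<sigma>1 C) + v"
      if k: "k \<le> ?K" "(2 ^ Suc k - 1) * real m \<le> C" "C \<le> 4 * (2 ^ k * real m)" "C > 0" for k
    proof -
      have "(1 - exp (- (1 / 4))) * f T \<le> f (Y k) + v"
        by (rule greedy_output_approx[OF Y[OF k(1)] I(1) sub mono f0 nonneg pos T])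
          (use k v v0 in auto)
      then show ?thesis using fY[OF k(1,2)] by simp
    qed
    have fT0: "f T \<ge> 0" using nonneg T by simp
    then have le1: "(1 - exp (- (1 / 4))) * f T \<le> f T"
      by (simp add: mult_left_le_one_le)
    have p1: "f (policy_output s \<sigma>1 C) \<ge> 0" using outI[OF perm] nonneg by blast
    have "(1 - exp (- (1 / 4))) * f T \<le> f (policy_output s \<sigma>1 C) + v"
    proof (cases "\<exists>k\<le>?K. (2 ^ Suc k - 1) * real m > C")
      case False
      \<comment> \<open>All phases fit, so the output contains \<open>Y ?K = I\<close> and dominates
        the optimum by monotonicity.\<close>
      then have "f (Y ?K) \<le> f (policy_output s \<sigma>1 C)" by (intro fY) (auto simp: not_less)
      moreover have "f T \<le> f (Y ?K)"
        unfolding YK by (rule mono_on_PowD[OF mono T(1) order.refl])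
      ultimately show ?thesis using le1 v0 by simp
    next
      case True
      \<comment> \<open>The first phase whose prefix bound exceeds \<open>C\<close>; its
        predecessor, if any, is the phase to which \<open>approx\<close> applies.\<close>
      define k where "k = (LEAST k. (2 ^ Suc k - 1) * real m > C)"
      obtain k0 where k0: "k0 \<le> ?K" "(2 ^ Suc k0 - 1) * real m > C" using True by blast
      have k: "(2 ^ Suc k - 1) * real m > C" "k \<le> ?K"
        using LeastI[of "\<lambda>k. (2 ^ Suc k - 1) * real m > C", OF k0(2)]
          Least_le[of "\<lambda>k. (2 ^ Suc k - 1) * real m > C", OF k0(2)] k0(1)
        unfolding k_def by linarith+
      show ?thesis
      proof (cases k)
        case 0
        \<comment> \<open>Here \<open>C < m\<close>, since \<open>2 ^ Suc 0 - 1 = 1\<close>: not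
          even the smallest item fits.\<close>
        have "T = {}"
        proof (rule ccontr)
          assume "T \<noteq> {}"
          then obtain i where i: "i \<in> T" by blast
          then have "m \<le> s i" using T(1) I unfolding m_def min_size_def by (intro Min_le) auto
          also have "s i \<le> (\<Sum>j\<in>T. s j)"
            using i T(1) I(1) finite_subset by (intro member_le_sum) auto
          finally have "real m \<le> C" using T(2) by linarith
          then show False using k(1) 0 by simp
        qed
        then show ?thesis using f0 p1 v0 by simp
      next
        case (Suc l)
        have lC: "(2 ^ Suc l - 1) * real m \<le> C"
          using not_less_Least[of l "\<lambda>k. (2 ^ Suc k - 1) * real m > C"] Suc
          unfolding k_def by simp
        have "(2 ^ Suc l - 1) * real m > 0"
          using m(1) one_less_power[of "2::real" "Suc l"] by (intro mult_pos_pos) auto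
        then have "C > 0" using lC by linarith
        \<comment> \<open>The overflow at phase \<open>l + 1\<close> gives
          \<open>C < (2 ^ (l + 2) - 1) * m\<close>.\<close>
        moreover have "C \<le> 4 * (2 ^ l * real m)"
          using k(1) Suc m(1) by (simp add: algebra_simps)
        ultimately show ?thesis using approx[OF _ lC] k(2) Suc by simp
      qed
    qed
    then show ?thesis unfolding T_def v_def .
  qed
qed

section \<open>The constant and the final statement\<close>

lemma fourth_root_exp: "1 / root 4 (exp 1) = exp (- (1 / 4) :: real)"
proof -
  have "root 4 (exp 1) = exp (1 / 4 :: real)"
    by (rule real_root_pos_unique) (simp_all flip: exp_of_nat_mult)
  then show ?thesis by (simp add: exp_minus field_simps)
qed

text \<open>The threshold is \<open>1 - 2 * 0.110\<close>. The quadratic Taylor bound at 1/4 gives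
  only 1.28125, short of \<open>100 / 78\<close>; at 1/8 it gives \<open>145 / 128\<close>, whose
  square suffices.\<close>

lemma exp_neg_quarter_less: "exp (- (1 / 4)) < (78 / 100 :: real)"
proof -
  have "(145 / 128)\<^sup>2 \<le> (exp (1 / 8) :: real)\<^sup>2"
    using exp_lower_Taylor_quadratic[of "1 / 8"]
    by (intro power_mono) (auto simp: power2_eq_square)
  also have "\<dots> = exp (1 / 4)" by (simp flip: exp_of_nat_mult)
  finally have "100 / 78 < (exp (1 / 4) :: real)" by (simp add: power2_eq_square)
  then show ?thesis by (simp add: exp_minus field_simps)
qed

theorem theorem4:
  fixes I :: "'a set" and s :: "'a \<Rightarrow> nat" and f :: "'a set \<Rightarrow> real"
    and \<sigma>1 \<sigma>2 :: "'a list"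
  assumes "finite I" and "I \<noteq> {}"
    and "\<And>i. i \<in> I \<Longrightarrow> s i > 0"
    and "\<And>X. X \<subseteq> I \<Longrightarrow> f X \<ge> 0"
    and "mono_on (Pow I) f"
    and "submodular_on I f"
    and "f {} = 0"
    and "is_doubling_sequence I s f \<sigma>1"
    and "is_value_sequence I f \<sigma>2"
  shows "randomized_universal_policy I (fair_mix \<sigma>1 \<sigma>2) \<and>
         robust I s f (1/2 * (1 - 1 / root 4 (exp 1))) (fair_mix \<sigma>1 \<sigma>2) \<and>
         (\<forall>C\<ge>0. (f (policy_output s \<sigma>1 C) + f (policy_output s \<sigma>2 C)) / 2
                 \<ge> 1/2 * (1 - 1 / root 4 (exp 1)) * f (opt_set I s f C)) \<and>
         1/2 * (1 - 1 / root 4 (exp 1)) > (0.110 :: real)"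
proof -
  have "randomized_universal_policy I (fair_mix \<sigma>1 \<sigma>2)"
    using mix_approx(1)[OF assms] assms(9)
    by (auto simp: randomized_universal_policy_def fair_mix_def is_value_sequence_def)
  moreover have "(f (policy_output s \<sigma>1 C) + f (policy_output s \<sigma>2 C)) / 2
      \<ge> 1/2 * (1 - 1 / root 4 (exp 1)) * f (opt_set I s f C)" if "C \<ge> 0" for C
    using mix_approx(2)[OF assms that] unfolding fourth_root_exp by simp
  moreover have "measure_pmf.expectation (fair_mix \<sigma>1 \<sigma>2) (\<lambda>\<sigma>. f (policy_output s \<sigma> C))
      = (f (policy_output s \<sigma>1 C) + f (policy_output s \<sigma>2 C)) / 2" for C
    by (simp add: fair_mix_def field_simps)
  ultimately show ?thesis
    using exp_neg_quarter_less unfolding robust_def fourth_root_exp by simp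
qed

end
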